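(* Let $y_{ex}\in\mathsf{Im}(A)$, $y_{ex}\neq 0$. For each $\delta>0$ let $y^\delta\in\mathcal{Y}$ satisfy $\|y^\delta-y_{ex}\|_\mathcal{Y}\le\delta$. Fix $r>1$ and $\varepsilon>0$, and define $$M(\delta):=\min\left\{M\in\mathbb{N}:\ \|AX_\varepsilon^M(y^\delta)-y^\delta\|_\mathcal{Y}\le r\delta\right\}$$ (this set is non-empty for every $\delta>0$). Then $\displaystyle\lim_{\delta\to0}\delta\sqrt{M(\delta)}=0$.
   Context: $\mathcal{X},\mathcal{Y}$ are real Hilbert spaces; $A:\mathcal{X}\to\mathcal{Y}$ is a continuous linear operator that is one-to-one, not onto, and has dense range in $\mathcal{Y}$. $b$ is a symmetric non-negative bilinear form on $\mathcal{X}$ with induced seminorm $\|x\|_b=\sqrt{b(x,x)}$, such that there are constants $c,C>0$ with $c^2\|x\|_\mathcal{X}^2\le \|Ax\|_\mathcal{Y}^2+\|x\|_b^2\le C^2\|x\|_\mathcal{X}^2$ for all $x\in\mathcal{X}$. $\mathbb{N}$ contains $0$. Iterated quasi-reversibility: for $\varepsilon>0$ and data $y\in\mathcal{Y}$, define $X_\varepsilon^{-1}(y)=0$ and, for $M\in\mathbb{N}$, $X_\varepsilon^M(y)$ is the unique element of $\mathcal{X}$ such that $$(AX_\varepsilon^M(y),Ax)_\mathcal{Y}+\varepsilon\, b(X_\varepsilon^M(y),x)=(y,Ax)_\mathcal{Y}+\varepsilon\, b(X_\varepsilon^{M-1}(y),x)\quad\forall x\in\mathcal{X}.$$ *)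

theory Defs
  imports "HOL-Analysis.Analysis"
begin

definition form_seminorm :: "('a \<Rightarrow> 'a \<Rightarrow> real) \<Rightarrow> 'a \<Rightarrow> real" where
  "form_seminorm b x = sqrt (b x x)"

definition qr_step ::
  "('a::real_inner \<Rightarrow> 'b::real_inner) \<Rightarrow> ('a \<Rightarrow> 'a \<Rightarrow> real) \<Rightarrow> real \<Rightarrow> 'b \<Rightarrow> 'a \<Rightarrow> 'a" where
  "qr_step A b \<epsilon> y z =
     (THE u. \<forall>x. A u \<bullet> A x + \<epsilon> * b u x = y \<bullet> A x + \<epsilon> * b z x)"

(* qr_iter A b \<epsilon> y M is the iterate X_\<epsilon>^M(y) for M \<ge> 0; the initial value
   X_\<epsilon>^{-1}(y) = 0 is the last argument of qr_step in the case M = 0. *)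
primrec qr_iter ::
  "('a::real_inner \<Rightarrow> 'b::real_inner) \<Rightarrow> ('a \<Rightarrow> 'a \<Rightarrow> real) \<Rightarrow> real \<Rightarrow> 'b \<Rightarrow> nat \<Rightarrow> 'a" where
  "qr_iter A b \<epsilon> y 0 = qr_step A b \<epsilon> y 0"
| "qr_iter A b \<epsilon> y (Suc M) = qr_step A b \<epsilon> y (qr_iter A b \<epsilon> y M)"

definition discrepancy_set ::
  "('a::real_inner \<Rightarrow> 'b::real_inner) \<Rightarrow> ('a \<Rightarrow> 'a \<Rightarrow> real) \<Rightarrow> real \<Rightarrow> real \<Rightarrow> real \<Rightarrow> 'b \<Rightarrow> nat set" where
  "discrepancy_set A b \<epsilon> r \<delta> y = {M. norm (A (qr_iter A b \<epsilon> y M) - y) \<le> r * \<delta>}"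

(* The minimum of a possibly infinite set of naturals; Min would be unspecified there. *)
definition stopping_index ::
  "('a::real_inner \<Rightarrow> 'b::real_inner) \<Rightarrow> ('a \<Rightarrow> 'a \<Rightarrow> real) \<Rightarrow> real \<Rightarrow> real \<Rightarrow> real \<Rightarrow> 'b \<Rightarrow> nat" where
  "stopping_index A b \<epsilon> r \<delta> y = (LEAST M. M \<in> discrepancy_set A b \<epsilon> r \<delta> y)"

end

theory Submission
  imports Defs
begin

text \<open>
  Let \<open>a u v = A u \<bullet> A v + \<epsilon> b u v\<close>, a scalar product equivalent to the given one, and let \<open>T\<close> be
  the operator with \<open>a (T z) x = \<epsilon> b z x\<close>. For exact data \<open>A x\<close> the error after \<open>M + 1\<close> steps is
  \<open>T ^ (M + 1) x\<close>, and the residual \<open>A (T ^ n x)\<close> has non-increasing norm. Since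
  \<open>\<parallel>A w\<parallel>\<^sup>2 \<le> a w w - a (T w) (T w)\<close>, the squared residuals are summable by telescoping, so
  Olivier's theorem makes them \<open>o(1/n)\<close>. The map from data to residual is linear and
  non-expansive, so noise contributes at most \<open>\<delta>\<close>, and failure of the discrepancy
  test at step \<open>M(\<delta>) - 1\<close> gives \<open>(r - 1) \<delta> < \<parallel>A (T ^ M(\<delta>) x)\<parallel> = o(1 / sqrt M(\<delta>))\<close>.
\<close>

section \<open>Olivier's theorem for monotone series\<close>

text \<open>At least \<open>n / 2\<close> indices lie in \<open>{n div 2..<n}\<close>, and each of
  their terms is at least \<open>q n\<close>. So \<open>n * q n\<close> is at most twice a block of
  the series that vanishes by convergence.\<close>

lemma decseq_summable_imp_mult_tendsto_zero:
  fixes q :: "nat \<Rightarrow> real"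
  assumes dec: "decseq q" and sm: "summable q"
  shows "(\<lambda>n. real n * q n) \<longlonglongrightarrow> 0"
proof -
  define S where "S n = (\<Sum>k<n. q k)" for n
  have S: "S \<longlonglongrightarrow> suminf q"
    unfolding S_def using sm by (rule summable_LIMSEQ)
  have "filterlim (\<lambda>n::nat. n div 2) at_top sequentially"
    by (rule filterlim_at_top_div_const_nat) simp
  then have S2: "(\<lambda>n. S (n div 2)) \<longlonglongrightarrow> suminf q"
    using S by (rule filterlim_compose[rotated])
  have lim: "(\<lambda>n. 2 * (S n - S (n div 2))) \<longlonglongrightarrow> 0"
    using tendsto_mult_left[OF tendsto_diff[OF S S2], of 2] by simp
  have "q \<longlonglongrightarrow> 0" using sm by (rule summable_LIMSEQ_zero)
  then have nonneg: "0 \<le> q n" for n using dec by (rule decseq_ge[rotated])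
  have upper: "real n * q n \<le> 2 * (S n - S (n div 2))" for n
  proof -
    have "S n = S (n div 2) + (\<Sum>k\<in>{n div 2..<n}. q k)"
      using sum.atLeastLessThan_concat[of 0 "n div 2" n q]
      by (simp add: S_def lessThan_atLeast0)
    then have tail: "(\<Sum>k\<in>{n div 2..<n}. q k) = S n - S (n div 2)" by simp
    have "real n * q n \<le> 2 * real (card {n div 2..<n}) * q n"
      using nonneg by (intro mult_right_mono) simp_all
    also have "\<dots> \<le> 2 * (\<Sum>k\<in>{n div 2..<n}. q k)"
      unfolding mult.assoc
      by (intro mult_left_mono sum_bounded_below) (use dec in \<open>auto simp: decseq_def\<close>)
    finally show ?thesis unfolding tail .
  qed
  show ?thesis
    by (rule tendsto_sandwich[OF _ _ tendsto_const lim])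
       (use nonneg upper in \<open>auto intro!: always_eventually\<close>)
qed

section \<open>Symmetric bilinear forms and the minimisation of quadratic functionals\<close>

lemma bilinear_Cauchy_Schwarz:
  fixes a :: "'a::real_vector \<Rightarrow> 'a \<Rightarrow> real"
  assumes bil: "bilinear a" and sym: "\<And>x y. a x y = a y x" and nonneg: "\<And>x. 0 \<le> a x x"
  shows "(a x y)\<^sup>2 \<le> a x x * a y y"
proof -
  have quad: "0 \<le> a x x - 2 * t * a x y + t\<^sup>2 * a y y" for t
  proof -
    have "a (x - t *\<^sub>R y) (x - t *\<^sub>R y) = a x x - 2 * t * a x y + t\<^sup>2 * a y y"
      using sym[of y x] bil
      by (simp add: bilinear_lsub bilinear_rsub bilinear_lmul bilinear_rmul power2_eq_square algebra_simps)
    then show ?thesis using nonneg[of "x - t *\<^sub>R y"] by simp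
  qed
  show ?thesis
  proof (cases "a y y = 0")
    case True
    have "a x y = 0"
    proof (rule ccontr)
      assume "a x y \<noteq> 0"
      \<comment> \<open>In this degenerate case the quadratic is affine in \<open>t\<close>; the
        chosen \<open>t\<close> gives it the value \<open>-1\<close>.\<close>
      then show False using quad[of "(a x x + 1) / (2 * a x y)"] True by simp
    qed
    then show ?thesis using True by simp
  next
    case False
    then have "0 < a y y" using nonneg[of y] by simp
    then show ?thesis
      \<comment> \<open>This \<open>t\<close> minimises the quadratic.\<close>
      using quad[of "a x y / a y y"] by (simp add: field_simps power2_eq_square)
  qed
qed

text \<open>Cauchy-Schwarz carries the bound from the diagonal to all pairs. Semidefiniteness
  suffices, so this serves both \<open>energy\<close> and \<open>b\<close>.\<close>

lemma bilinear_bounded_if_diagonal_bounded: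
  fixes a :: "'a::real_normed_vector \<Rightarrow> 'a \<Rightarrow> real"
  assumes bil: "bilinear a" and sym: "\<And>x y. a x y = a y x" and nonneg: "\<And>x. 0 \<le> a x x"
    and upper: "\<And>x. a x x \<le> K * (norm x)\<^sup>2" and "0 \<le> K"
  shows "bounded_bilinear a"
proof
  show "\<exists>K. \<forall>x y. norm (a x y) \<le> norm x * norm y * K"
  proof (intro exI allI)
    fix x y
    have "(a x y)\<^sup>2 \<le> a x x * a y y"
      by (rule bilinear_Cauchy_Schwarz[OF bil sym nonneg])
    also have "\<dots> \<le> (K * (norm x)\<^sup>2) * (K * (norm y)\<^sup>2)"
      using upper nonneg \<open>0 \<le> K\<close> by (intro mult_mono) auto
    also have "\<dots> = (norm x * norm y * K)\<^sup>2" by (simp add: power2_eq_square)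
    finally show "norm (a x y) \<le> norm x * norm y * K"
      using \<open>0 \<le> K\<close> by (simp add: abs_le_square_iff[symmetric])
  qed
qed (use bil in \<open>auto simp: bilinear_ladd bilinear_radd bilinear_lmul bilinear_rmul\<close>)

text \<open>The symmetric Lax-Milgram theorem by the direct method: a minimising sequence of
  \<open>J\<close> is Cauchy, and stationarity of \<open>J\<close> at its limit is the desired
  identity.\<close>

lemma coercive_form_representation:
  fixes a :: "'a::{real_normed_vector, complete_space} \<Rightarrow> 'a \<Rightarrow> real"
  assumes "bounded_bilinear a" and sym: "\<And>x y. a x y = a y x"
    and "0 < m" and coercive: "\<And>x. m * (norm x)\<^sup>2 \<le> a x x"
    and "bounded_linear f"
  shows "\<exists>!u. \<forall>x. a u x = f x"
proof -
  interpret a: bounded_bilinear a by fact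
  interpret f: bounded_linear f by fact
  define J where "J u = a u u - 2 * f u" for u
  obtain L where L: "\<And>x. norm (f x) \<le> norm x * L" using f.bounded by blast
  have J_below: "- (L\<^sup>2 / m) \<le> J u" for u
  proof -
    \<comment> \<open>Completing the square in \<open>norm u\<close> bounds \<open>J\<close> from
      below.\<close>
    have "0 \<le> (m * norm u - L)\<^sup>2 / m" using \<open>0 < m\<close> by simp
    also have "\<dots> = m * (norm u)\<^sup>2 - 2 * (norm u * L) + L\<^sup>2 / m"
      using \<open>0 < m\<close> by (simp add: field_simps power2_eq_square)
    also have "\<dots> \<le> J u + L\<^sup>2 / m"
      unfolding J_def using coercive[of u] L[of u] by simp
    finally show ?thesis by simp
  qed
  then have bdd: "bdd_below (range J)" by (meson bdd_below.I2)
  define j where "j = Inf (range J)"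
  have j_le: "j \<le> J u" for u unfolding j_def using bdd by (simp add: cInf_lower)
  have "\<exists>u. J u < j + 1 / real (Suc n)" for n
  proof -
    have "Inf (range J) < j + 1 / real (Suc n)" unfolding j_def by simp
    then show ?thesis using bdd by (subst (asm) cInf_less_iff) auto
  qed
  then obtain u where u: "\<And>n. J (u n) < j + 1 / real (Suc n)" by metis
  \<comment> \<open>The contributions of \<open>f\<close> cancel. As \<open>J\<close> is at least
    \<open>j\<close> at the midpoint, two near-minimisers must be close to each other.\<close>
  have parallelogram: "a (v - w) (v - w) = 2 * J v + 2 * J w - 4 * J ((1/2) *\<^sub>R (v + w))" for v w
    unfolding J_def using sym[of w v]
    by (simp add: a.diff_left a.diff_right a.add_left a.add_right a.scaleR_left a.scaleR_right
        f.add f.scaleR algebra_simps)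
  have near: "m * (dist (u k) (u l))\<^sup>2 \<le> 4 / real (Suc n)" if "n \<le> k" "n \<le> l" for k l n
  proof -
    have "m * (dist (u k) (u l))\<^sup>2 \<le> 2 * J (u k) + 2 * J (u l) - 4 * J ((1/2) *\<^sub>R (u k + u l))"
      using coercive[of "u k - u l"] by (simp add: parallelogram dist_norm)
    also have "\<dots> \<le> 2 / real (Suc k) + 2 / real (Suc l)"
      using u[of k] u[of l] j_le[of "(1/2) *\<^sub>R (u k + u l)"] by linarith
    also have "\<dots> \<le> 2 / real (Suc n) + 2 / real (Suc n)"
      using that by (intro add_mono divide_left_mono) auto
    finally show ?thesis by simp
  qed
  have "Cauchy u"
  proof (rule metric_CauchyI)
    fix e :: real assume "0 < e"
    then have "0 < m * e\<^sup>2 / 4" using \<open>0 < m\<close> by simp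
    then obtain n where "inverse (real (Suc n)) < m * e\<^sup>2 / 4"
      using reals_Archimedean by blast
    then have n: "4 / real (Suc n) < m * e\<^sup>2" by (simp add: field_simps)
    show "\<exists>M. \<forall>k\<ge>M. \<forall>l\<ge>M. dist (u k) (u l) < e"
    proof (intro exI allI impI)
      fix k l assume "n \<le> k" "n \<le> l"
      then have "m * (dist (u k) (u l))\<^sup>2 < m * e\<^sup>2" using near n by (meson le_less_trans)
      then show "dist (u k) (u l) < e"
        using \<open>0 < m\<close> \<open>0 < e\<close> by (simp add: power_less_imp_less_base)
    qed
  qed
  then obtain v where v: "u \<longlonglongrightarrow> v" using Cauchy_convergent convergentD by blast
  have "(\<lambda>n. J (u n)) \<longlonglongrightarrow> J v"
    unfolding J_def by (intro tendsto_intros a.tendsto f.tendsto v)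
  moreover have "(\<lambda>n. j + 1 / real (Suc n)) \<longlonglongrightarrow> j"
    using tendsto_add[OF tendsto_const LIMSEQ_inverse_real_of_nat, of j] by (simp add: inverse_eq_divide)
  ultimately have "J v \<le> j"
    by (rule LIMSEQ_le) (use u less_imp_le in blast)
  then have min: "J v \<le> J w" for w using j_le[of w] by linarith
  have rep: "a v x = f x" for x
  proof (cases "x = 0")
    case False
    then have pos: "0 < a x x"
      using coercive[of x] \<open>0 < m\<close> by (smt (verit) mult_pos_pos zero_less_norm_iff zero_less_power)
    define s where "s = a v x - f x"
    \<comment> \<open>The minimiser of \<open>J\<close> along the line \<open>v + t x\<close>; it
      would lower \<open>J\<close> by \<open>s\<^sup>2 / a x x\<close>, which forces
      \<open>s = 0\<close>.\<close>
    define t where "t = - (s / a x x)"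
    have "J (v + t *\<^sub>R x) = J v + (2 * t * s + t\<^sup>2 * a x x)"
      unfolding J_def s_def using sym[of x v]
      by (simp add: a.add_left a.add_right a.scaleR_left a.scaleR_right f.add f.scaleR
          algebra_simps power2_eq_square)
    moreover have "2 * t * s + t\<^sup>2 * a x x = - (s\<^sup>2 / a x x)"
      unfolding t_def using pos by (simp add: field_simps power2_eq_square)
    ultimately have "s\<^sup>2 / a x x \<le> 0" using min[of "v + t *\<^sub>R x"] by linarith
    then have "s = 0" using pos by (simp add: divide_le_0_iff)
    then show ?thesis by (simp add: s_def)
  qed (simp add: a.zero_right f.zero)
  show ?thesis
  proof (rule ex1I[of _ v])
    fix w assume "\<forall>x. a w x = f x"
    then have "a (w - v) (w - v) = 0" by (simp add: a.diff_left rep)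
    then have "m * (norm (w - v))\<^sup>2 \<le> 0" using coercive[of "w - v"] by simp
    then show "w = v" using \<open>0 < m\<close> by (simp add: mult_le_0_iff)
  qed (simp add: rep)
qed

section \<open>The regularised step as a variational equation\<close>

locale quasi_reversibility =
  fixes A :: "'a::{real_inner, complete_space} \<Rightarrow> 'b::real_inner"
    and b :: "'a \<Rightarrow> 'a \<Rightarrow> real" and c C \<epsilon> :: real
  assumes A: "bounded_linear A"
    and b: "bilinear b" and b_sym: "b x z = b z x" and b_nonneg: "0 \<le> b x x"
    and c_pos: "0 < c" and \<epsilon>_pos: "0 < \<epsilon>"
    and lower: "c\<^sup>2 * (norm x)\<^sup>2 \<le> (norm (A x))\<^sup>2 + b x x"
    and upper: "(norm (A x))\<^sup>2 + b x x \<le> C\<^sup>2 * (norm x)\<^sup>2"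
begin

sublocale A: bounded_linear A by (rule A)

definition energy :: "'a \<Rightarrow> 'a \<Rightarrow> real" where
  "energy u x = A u \<bullet> A x + \<epsilon> * b u x"

lemma energy_sym: "energy u x = energy x u"
  by (simp add: energy_def inner_commute b_sym)

lemma norm_A_le_energy: "(norm (A x))\<^sup>2 \<le> energy x x"
  using b_nonneg[of x] \<epsilon>_pos by (simp add: energy_def power2_norm_eq_inner)

lemma energy_nonneg: "0 \<le> energy x x"
  using norm_A_le_energy[of x] by (meson order_trans zero_le_power2)

lemma energy_bilinear: "bilinear energy"
  unfolding bilinear_def linear_iff energy_def
  by (auto simp: A.add A.scaleR inner_add_left inner_add_right bilinear_ladd[OF b]
      bilinear_radd[OF b] bilinear_lmul[OF b] bilinear_rmul[OF b] algebra_simps)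

text \<open>Both weights \<open>1\<close> and \<epsilon> are at least
  \<open>min 1 \<epsilon>\<close>, so the lower bound for the unweighted sum transfers.\<close>

lemma energy_coercive: "min 1 \<epsilon> * c\<^sup>2 * (norm x)\<^sup>2 \<le> energy x x"
proof -
  have "min 1 \<epsilon> * (c\<^sup>2 * (norm x)\<^sup>2) \<le> min 1 \<epsilon> * ((norm (A x))\<^sup>2 + b x x)"
    using lower \<epsilon>_pos by (intro mult_left_mono) auto
  also have "\<dots> = min 1 \<epsilon> * (norm (A x))\<^sup>2 + min 1 \<epsilon> * b x x"
    by (rule distrib_left)
  also have "\<dots> \<le> 1 * (norm (A x))\<^sup>2 + \<epsilon> * b x x"
    using b_nonneg by (intro add_mono mult_right_mono) auto
  finally show ?thesis by (simp add: energy_def power2_norm_eq_inner mult.assoc)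
qed

lemma energy_le: "energy x x \<le> max 1 \<epsilon> * C\<^sup>2 * (norm x)\<^sup>2"
proof -
  have "energy x x \<le> max 1 \<epsilon> * (norm (A x))\<^sup>2 + max 1 \<epsilon> * b x x"
    unfolding energy_def power2_norm_eq_inner[symmetric]
    using b_nonneg by (intro add_mono mult_right_mono) (auto simp: mult_le_cancel_right1)
  also have "\<dots> = max 1 \<epsilon> * ((norm (A x))\<^sup>2 + b x x)"
    by (rule distrib_left[symmetric])
  also have "\<dots> \<le> max 1 \<epsilon> * (C\<^sup>2 * (norm x)\<^sup>2)"
    using upper by (intro mult_left_mono) auto
  finally show ?thesis by (simp add: mult.assoc)
qed

lemma b_le: "b x x \<le> C\<^sup>2 * (norm x)\<^sup>2"
  using upper[of x] zero_le_power2[of "norm (A x)"] by linarith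

text \<open>Well-posedness of one step, which gives the definite description in
  \<open>qr_step\<close> its meaning.\<close>

lemma qr_step_ex1: "\<exists>!u. \<forall>x. energy u x = y \<bullet> A x + \<epsilon> * b z x"
proof (rule coercive_form_representation[of energy "min 1 \<epsilon> * c\<^sup>2"])
  show "bounded_bilinear energy"
    using energy_bilinear energy_sym energy_nonneg energy_le
    by (rule bilinear_bounded_if_diagonal_bounded) simp
  have "bounded_bilinear b"
    using b b_sym b_nonneg b_le by (rule bilinear_bounded_if_diagonal_bounded) simp
  then show "bounded_linear (\<lambda>x. y \<bullet> A x + \<epsilon> * b z x)"
    by (intro bounded_linear_add bounded_linear_const_mult A
        bounded_linear_compose[OF bounded_linear_inner_right]
        bounded_bilinear.bounded_linear_right)
qed (use energy_sym energy_coercive c_pos \<epsilon>_pos in auto)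

lemma energy_qr_step: "energy (qr_step A b \<epsilon> y z) x = y \<bullet> A x + \<epsilon> * b z x"
  using theI'[OF qr_step_ex1[of y z]] by (simp add: qr_step_def energy_def)

lemma qr_step_eqI:
  "(\<And>x. energy u x = y \<bullet> A x + \<epsilon> * b z x) \<Longrightarrow> qr_step A b \<epsilon> y z = u"
  using qr_step_ex1[of y z] energy_qr_step by blast

section \<open>Linearity of the iteration and residual estimates\<close>

lemmas energy_diff = bilinear_lsub[OF energy_bilinear] bilinear_rsub[OF energy_bilinear]

lemma qr_step_diff:
  "qr_step A b \<epsilon> (y - y') (z - z') = qr_step A b \<epsilon> y z - qr_step A b \<epsilon> y' z'"
  by (rule qr_step_eqI)
     (simp add: energy_diff energy_qr_step bilinear_lsub[OF b] inner_diff_left algebra_simps)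

lemma qr_iter_diff:
  "qr_iter A b \<epsilon> (y - y') M = qr_iter A b \<epsilon> y M - qr_iter A b \<epsilon> y' M"
  \<comment> \<open>The base case needs the initial value \<open>0\<close> in the form
    \<open>0 - 0\<close>.\<close>
  by (induction M) (use qr_step_diff[of y y' 0 0] in \<open>simp_all add: qr_step_diff\<close>)

text \<open>Subtracting \<open>energy z x\<close> from the defining equation cancels
  \<open>\<epsilon> * b z x\<close>, so the residual before the step drives the increment.\<close>

lemma energy_increment:
  "energy (qr_step A b \<epsilon> y z - z) x = (y - A z) \<bullet> A x"
  by (simp add: energy_diff energy_qr_step) (simp add: energy_def inner_diff_left)

text \<open>The new residual is the old one minus \<open>A h\<close>. In its squared norm the cross
  term is \<open>-2 * energy h h\<close>, which outweighs
  \<open>(norm (A h))\<^sup>2\<close>.\<close>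

lemma norm_residual_qr_step_le: "norm (y - A (qr_step A b \<epsilon> y z)) \<le> norm (y - A z)"
proof -
  define h where "h = qr_step A b \<epsilon> y z - z"
  have "(norm (y - A z - A h))\<^sup>2 = (norm (y - A z))\<^sup>2 - 2 * ((y - A z) \<bullet> A h) + (norm (A h))\<^sup>2"
    by (simp add: power2_norm_eq_inner inner_diff_left inner_diff_right inner_commute)
  also have "(y - A z) \<bullet> A h = energy h h"
    by (simp add: h_def energy_increment)
  finally have "(norm (y - A z - A h))\<^sup>2 \<le> (norm (y - A z))\<^sup>2"
    using norm_A_le_energy[of h] energy_nonneg[of h] by linarith
  then have "norm (y - A z - A h) \<le> norm (y - A z)"
    by (rule power2_le_imp_le) simp
  then show ?thesis by (simp add: h_def A.diff)
qed

lemma norm_residual_qr_iter_le: "norm (y - A (qr_iter A b \<epsilon> y M)) \<le> norm y"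
proof (induction M)
  case 0
  then show ?case using norm_residual_qr_step_le[of y 0] by (simp add: A.zero)
next
  case (Suc M)
  then show ?case using norm_residual_qr_step_le order_trans by fastforce
qed

text \<open>By linearity the residuals for \<open>y\<close> and \<open>y'\<close> differ by the
  residual for data \<open>y - y'\<close>, which is at most its data in norm.\<close>

lemma norm_residual_noise_le:
  "norm (y - A (qr_iter A b \<epsilon> y M)) \<le> norm (y' - A (qr_iter A b \<epsilon> y' M)) + norm (y - y')"
proof -
  have "y - A (qr_iter A b \<epsilon> y M) =
      (y' - A (qr_iter A b \<epsilon> y' M)) + ((y - y') - A (qr_iter A b \<epsilon> (y - y') M))"
    by (simp add: qr_iter_diff A.diff)
  also have "norm \<dots> \<le> norm (y' - A (qr_iter A b \<epsilon> y' M)) + norm (y - y')"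
    by (rule order_trans[OF norm_triangle_ineq add_left_mono[OF norm_residual_qr_iter_le]])
  finally show ?thesis .
qed

section \<open>Error propagation for exact data\<close>

abbreviation T :: "'a \<Rightarrow> 'a" where "T \<equiv> qr_step A b \<epsilon> 0"

text \<open>For data \<open>A x\<close> the point \<open>x\<close> is fixed by the step; linearity
  then leaves a step with data \<open>0\<close>.\<close>

lemma qr_step_exact_error: "x - qr_step A b \<epsilon> (A x) z = T (x - z)"
proof -
  have "qr_step A b \<epsilon> (A x) x = x"
    by (rule qr_step_eqI) (simp add: energy_def)
  then show ?thesis using qr_step_diff[of "A x" "A x" x z] by simp
qed

text \<open>The exponent is \<open>Suc M\<close> because iterate \<open>0\<close> is already one
  step away from the initial value \<open>0\<close>.\<close>

lemma qr_iter_exact_error: "x - qr_iter A b \<epsilon> (A x) M = (T ^^ Suc M) x"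
  by (induction M) (simp_all add: qr_step_exact_error)

lemma norm_A_T_le: "norm (A (T w)) \<le> norm (A w)"
  using norm_residual_qr_step_le[of 0 w] by simp

text \<open>With \<open>h = w - T w\<close>, the decrease equals
  \<open>2 * energy h w - energy h h\<close>. Here \<open>energy h w\<close> is
  \<open>(norm (A w))\<^sup>2\<close>, and \<open>energy h h\<close> is at most that.\<close>

lemma energy_T_decrease: "(norm (A w))\<^sup>2 \<le> energy w w - energy (T w) (T w)"
proof -
  define h where "h = w - T w"
  have h: "energy h x = A w \<bullet> A x" for x
    using energy_increment[of 0 w x] by (simp add: h_def energy_diff)
  have "(norm (A w - A h))\<^sup>2 = (norm (A w))\<^sup>2 - 2 * (A w \<bullet> A h) + (norm (A h))\<^sup>2"
    by (simp add: power2_norm_eq_inner inner_diff_left inner_diff_right inner_commute)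
  \<comment> \<open>Here \<open>energy h h = A w \<bullet> A h\<close>. The term
    \<open>(norm (A h))\<^sup>2\<close> is afterwards absorbed by one copy of
    \<open>energy h h\<close>.\<close>
  then have "2 * energy h h \<le> (norm (A w))\<^sup>2 + (norm (A h))\<^sup>2"
    using zero_le_power2[of "norm (A w - A h)"] by (simp add: h)
  then have "energy h h \<le> (norm (A w))\<^sup>2"
    using norm_A_le_energy[of h] by linarith
  moreover have "energy (w - h) (w - h) = energy w w - 2 * energy h w + energy h h"
    using energy_sym[of w h] by (simp add: energy_diff)
  moreover have "energy h w = (norm (A w))\<^sup>2"
    by (simp add: h power2_norm_eq_inner)
  ultimately show ?thesis by (simp add: h_def)
qed

lemma exact_residual_decay: "(\<lambda>n. sqrt (real n) * norm (A ((T ^^ n) x))) \<longlonglongrightarrow> 0"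
proof -
  define q where "q n = (norm (A ((T ^^ n) x)))\<^sup>2" for n
  define p where "p n = energy ((T ^^ n) x) ((T ^^ n) x)" for n
  have "decseq q"
    unfolding q_def by (rule decseq_SucI) (simp add: norm_A_T_le power_mono)
  moreover have "summable q"
  proof (rule summableI_nonneg_bounded)
    fix n
    have "(\<Sum>k<n. q k) \<le> (\<Sum>k<n. p k - p (Suc k))"
      unfolding q_def p_def using energy_T_decrease by (intro sum_mono) simp
    also have "\<dots> = p 0 - p n" by (rule sum_lessThan_telescope')
    also have "\<dots> \<le> p 0" using energy_nonneg by (simp add: p_def)
    finally show "(\<Sum>k<n. q k) \<le> p 0" .
  qed (simp add: q_def)
  ultimately have "(\<lambda>n. sqrt (real n * q n)) \<longlonglongrightarrow> sqrt 0"
    by (intro tendsto_real_sqrt decseq_summable_imp_mult_tendsto_zero)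
  then show ?thesis by (simp add: q_def real_sqrt_mult)
qed

lemma exact_residual_tendsto_zero: "(\<lambda>n. norm (A ((T ^^ n) x))) \<longlonglongrightarrow> 0"
proof (rule tendsto_sandwich[OF _ _ tendsto_const exact_residual_decay[of x]])
  show "\<forall>\<^sub>F n in sequentially. norm (A ((T ^^ n) x)) \<le> sqrt (real n) * norm (A ((T ^^ n) x))"
    by (rule eventually_sequentiallyI[of 1]) (simp add: mult_le_cancel_right1)
qed simp

section \<open>The discrepancy principle\<close>

lemma residual_le:
  assumes "norm (y - A x) \<le> \<delta>"
  shows "norm (A (qr_iter A b \<epsilon> y M) - y) \<le> norm (A ((T ^^ Suc M) x)) + \<delta>"
  using norm_residual_noise_le[of y M "A x"] assms
  by (simp only: qr_iter_exact_error[symmetric] A.diff norm_minus_commute[of _ y])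

lemma discrepancy_set_nonempty:
  assumes "norm (y - A x) \<le> \<delta>" and "1 < r" and "0 < \<delta>"
  shows "discrepancy_set A b \<epsilon> r \<delta> y \<noteq> {}"
proof -
  have "\<forall>\<^sub>F n in sequentially. norm (A ((T ^^ Suc n) x)) < (r - 1) * \<delta>"
    using exact_residual_tendsto_zero[of x, THEN LIMSEQ_Suc] assms
    by (intro order_tendstoD(2)) auto
  then obtain M where "norm (A ((T ^^ Suc M) x)) < (r - 1) * \<delta>"
    using eventually_happens' sequentially_bot by blast
  then have "norm (A (qr_iter A b \<epsilon> y M) - y) \<le> r * \<delta>"
    using residual_le[OF assms(1), of M] by (simp add: algebra_simps)
  then show ?thesis by (auto simp: discrepancy_set_def)
qed

text \<open>Positivity of the index provides a preceding step at which the test failed. The shift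
  between iterate \<open>M\<close> and power \<open>Suc M\<close> makes the exponent exactly the
  stopping index.\<close>

lemma stopping_index_residual:
  assumes "norm (y - A x) \<le> \<delta>" and "0 < stopping_index A b \<epsilon> r \<delta> y"
  shows "(r - 1) * \<delta> < norm (A ((T ^^ stopping_index A b \<epsilon> r \<delta> y) x))"
proof -
  obtain M where M: "stopping_index A b \<epsilon> r \<delta> y = Suc M"
    using assms(2) gr0_conv_Suc by blast
  have "M \<notin> discrepancy_set A b \<epsilon> r \<delta> y"
    by (rule not_less_Least) (simp add: M[unfolded stopping_index_def])
  then have "r * \<delta> < norm (A (qr_iter A b \<epsilon> y M) - y)"
    by (simp add: discrepancy_set_def)
  also have "\<dots> \<le> norm (A ((T ^^ Suc M) x)) + \<delta>"
    by (rule residual_le[OF assms(1)])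
  finally show ?thesis unfolding M by (simp add: algebra_simps)
qed

lemma stopping_index_tendsto:
  assumes noise: "\<And>\<delta>. 0 < \<delta> \<Longrightarrow> norm (y \<delta> - A x) \<le> \<delta>" and "1 < r"
  shows "((\<lambda>\<delta>. \<delta> * sqrt (real (stopping_index A b \<epsilon> r \<delta> (y \<delta>)))) \<longlongrightarrow> 0) (at_right 0)"
proof (rule tendstoI)
  fix \<eta> :: real assume "0 < \<eta>"
  then have "\<forall>\<^sub>F n in sequentially. sqrt (real n) * norm (A ((T ^^ n) x)) < (r - 1) * \<eta>"
    using exact_residual_decay[of x] \<open>1 < r\<close> by (intro order_tendstoD(2)) auto
  \<comment> \<open>\<open>N\<close> depends on \<eta> but not on \<delta>.\<close>
  then obtain N where N: "\<And>n. N \<le> n \<Longrightarrow> sqrt (real n) * norm (A ((T ^^ n) x)) < (r - 1) * \<eta>"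
    unfolding eventually_sequentially by blast
  have "((\<lambda>\<delta>. \<delta> * sqrt (real N)) \<longlongrightarrow> 0 * sqrt (real N)) (at_right 0)"
    by (intro tendsto_intros)
  then have "\<forall>\<^sub>F \<delta> in at_right 0. \<delta> * sqrt (real N) < \<eta>"
    using \<open>0 < \<eta>\<close> by (intro order_tendstoD(2)) auto
  then show "\<forall>\<^sub>F \<delta> in at_right 0.
      dist (\<delta> * sqrt (real (stopping_index A b \<epsilon> r \<delta> (y \<delta>)))) 0 < \<eta>"
    using eventually_at_right_less
  proof eventually_elim
    case (elim \<delta>)
    define M where "M = stopping_index A b \<epsilon> r \<delta> (y \<delta>)"
    have "\<delta> * sqrt (real M) < \<eta>"
    \<comment> \<open>The stopping index need not tend to infinity, so small indices are treated
      apart. Index \<open>0\<close> belongs with them even if \<open>N = 0\<close>, since no failed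
      test precedes it.\<close>
    proof (cases "N \<le> M \<and> 0 < M")
      case True
      then have "(r - 1) * \<delta> < norm (A ((T ^^ M) x))"
        using stopping_index_residual[OF noise[OF elim(2)]] by (simp add: M_def)
      then have "sqrt (real M) * ((r - 1) * \<delta>) \<le> sqrt (real M) * norm (A ((T ^^ M) x))"
        by (intro mult_left_mono) auto
      also have "\<dots> < (r - 1) * \<eta>" using N True by blast
      finally have "(r - 1) * (\<delta> * sqrt (real M)) < (r - 1) * \<eta>" by (simp add: mult_ac)
      then show ?thesis using \<open>1 < r\<close> by simp
    next
      case False
      \<comment> \<open>Either \<open>M < N\<close> or \<open>M = 0\<close>, hence
        \<open>M \<le> N\<close>.\<close>
      then have "\<delta> * sqrt (real M) \<le> \<delta> * sqrt (real N)"
        using elim(2) by (intro mult_left_mono) auto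
      then show ?thesis using elim(1) by linarith
    qed
    then show ?case using elim(2) by (simp add: M_def)
  qed
qed

end

theorem proposition15:
  fixes A :: "'a::{real_inner, complete_space} \<Rightarrow> 'b::{real_inner, complete_space}"
    and b :: "'a \<Rightarrow> 'a \<Rightarrow> real"
    and c C \<epsilon> r :: real
    and y_ex :: 'b
    and y_noisy :: "real \<Rightarrow> 'b"
  assumes "bounded_linear A"
    and "inj A"
    and "\<not> surj A"
    and "closure (range A) = UNIV"
    and "bilinear b"
    and "\<And>x z. b x z = b z x"
    and "\<And>x. 0 \<le> b x x"
    and "0 < c" and "0 < C"
    and "\<And>x. c\<^sup>2 * (norm x)\<^sup>2 \<le> (norm (A x))\<^sup>2 + (form_seminorm b x)\<^sup>2"
    and "\<And>x. (norm (A x))\<^sup>2 + (form_seminorm b x)\<^sup>2 \<le> C\<^sup>2 * (norm x)\<^sup>2"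
    and "y_ex \<in> range A"
    and "y_ex \<noteq> 0"
    and "\<And>\<delta>. 0 < \<delta> \<Longrightarrow> norm (y_noisy \<delta> - y_ex) \<le> \<delta>"
    and "1 < r"
    and "0 < \<epsilon>"
  shows "(\<forall>\<delta>>0. discrepancy_set A b \<epsilon> r \<delta> (y_noisy \<delta>) \<noteq> {}) \<and>
         ((\<lambda>\<delta>. \<delta> * sqrt (real (stopping_index A b \<epsilon> r \<delta> (y_noisy \<delta>)))) \<longlongrightarrow> 0) (at_right 0)"
proof -
  have seminorm: "(form_seminorm b x)\<^sup>2 = b x x" for x
    using assms(7) by (simp add: form_seminorm_def)
  interpret quasi_reversibility A b c C \<epsilon>
    by (rule quasi_reversibility.intro) (use assms(1,5-8,10,11,16) in \<open>auto simp: seminorm\<close>)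
  obtain x where x: "y_ex = A x" using assms(12) by blast
  then have noise: "norm (y_noisy \<delta> - A x) \<le> \<delta>" if "0 < \<delta>" for \<delta>
    using assms(14) that by simp
  show ?thesis
    using discrepancy_set_nonempty[OF noise] stopping_index_tendsto[OF noise] assms(15) by blast
qed

end
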